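(* Let $M$ and $N$ be matroids on disjoint finite sets $S$ and $T$, and let $A\subseteq S$, $B\subseteq T$. Then \[(M,N;A,B)^*=(N^*,M^*;B,A),\] where the right side is the principal sum of $N^*$ (on $T$) and $M^*$ (on $S$) with respect to $B\subseteq T$ and $A\subseteq S$.
   Context: For matroids $M'$ on $S'$ and $N'$ on $T'$ with $S'\cap T'=\emptyset$, and $A'\subseteq S'$, $B'\subseteq T'$, the principal sum $(M',N';A',B')$ is the matroid union $M'^+(A',B')\vee N'_0$, where: $N'_0=N'\oplus U_{0,S'}$ ($N'$ with the elements of $S'$ added as loops); $M'^+(A',B')$ is the matroid on $S'\cup T'$ obtained from $M'$ by adding each element of $B'$ freely (by successive principal extensions) to the flat $\mathrm{cl}_{M'}(A')$ and each element of $T'-B'$ as a loop, equivalently the matroid with rank function $r(X\cup Y)=\min\{r_{M'}(X\cup A'),\,r_{M'}(X)+|Y\cap B'|\}$ for $X\subseteq S'$, $Y\subseteq T'$; and the matroid union $G\vee H$ of matroids on a common set has as independent sets the unions of an independent set of $G$ and an independent set of $H$. *)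

theory Defs
  imports Main
begin

text \<open>
  A matroid is given by its ground set and its family of independent sets, so equality of
  two such records is equality of matroids.  The operations below are defined on
  arbitrary records; they have their usual meaning on those satisfying the predicate
  \<open>matroid\<close>.
\<close>

record 'a set_system =
  ground :: "'a set"
  indeps :: "'a set set"

locale matroid =
  fixes M :: "'a set_system"
  assumes finite_ground: "finite (ground M)"
    and indep_subset_ground: "I \<in> indeps M \<Longrightarrow> I \<subseteq> ground M"
    and indep_empty: "{} \<in> indeps M"
    and indep_mono: "I \<in> indeps M \<Longrightarrow> J \<subseteq> I \<Longrightarrow> J \<in> indeps M"
    and indep_augment:
      "I \<in> indeps M \<Longrightarrow> J \<in> indeps M \<Longrightarrow> card I < card J \<Longrightarrow> \<exists>x\<in>J - I. insert x I \<in> indeps M"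

definition rank :: "'a set_system \<Rightarrow> 'a set \<Rightarrow> nat" where
  "rank M X = Max (card ` {I \<in> indeps M. I \<subseteq> X})"

definition bases :: "'a set_system \<Rightarrow> 'a set set" where
  "bases M = {I \<in> indeps M. \<forall>J\<in>indeps M. I \<subseteq> J \<longrightarrow> J = I}"

text \<open>The bases of the dual are the complements of the bases.\<close>

definition dual :: "'a set_system \<Rightarrow> 'a set_system" where
  "dual M = \<lparr>ground = ground M,
     indeps = {X. \<exists>C\<in>bases M. X \<subseteq> ground M - C}\<rparr>"

definition uniform :: "nat \<Rightarrow> 'a set \<Rightarrow> 'a set_system" where
  "uniform k E = \<lparr>ground = E, indeps = {X. X \<subseteq> E \<and> card X \<le> k}\<rparr>"

text \<open>The direct sum is only meant for disjoint ground sets.\<close>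

definition direct_sum :: "'a set_system \<Rightarrow> 'a set_system \<Rightarrow> 'a set_system" where
  "direct_sum M N = \<lparr>ground = ground M \<union> ground N,
     indeps = {I \<union> J | I J. I \<in> indeps M \<and> J \<in> indeps N}\<rparr>"

text \<open>The matroid union is only meant for a common ground set.\<close>

definition matroid_union :: "'a set_system \<Rightarrow> 'a set_system \<Rightarrow> 'a set_system" where
  "matroid_union G H = \<lparr>ground = ground G \<union> ground H,
     indeps = {I \<union> J | I J. I \<in> indeps G \<and> J \<in> indeps H}\<rparr>"

text \<open>
  \<open>free_extension M T A B\<close> is the matroid $M^+(A,B)$ on $S \cup T$, where $S$ is the ground
  set of $M$: the elements of $B$ are added freely to the flat spanned by $A$, those of
  $T - B$ as loops.  Its rank function is
  \[ r(X \cup Y) = \min \{r_M(X \cup A),\; r_M(X) + |Y \cap B|\} \qquad (X \subseteq S,\ Y \subseteq T), \]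
  and a set is independent iff its rank equals its cardinality.
\<close>

definition free_extension_rank ::
    "'a set_system \<Rightarrow> 'a set \<Rightarrow> 'a set \<Rightarrow> 'a set \<Rightarrow> 'a set \<Rightarrow> nat" where
  "free_extension_rank M A B X Y = min (rank M (X \<union> A)) (rank M X + card (Y \<inter> B))"

definition free_extension ::
    "'a set_system \<Rightarrow> 'a set \<Rightarrow> 'a set \<Rightarrow> 'a set \<Rightarrow> 'a set_system" where
  "free_extension M T A B = \<lparr>ground = ground M \<union> T,
     indeps = {X \<union> Y | X Y. X \<subseteq> ground M \<and> Y \<subseteq> T \<and>
       free_extension_rank M A B X Y = card (X \<union> Y)}\<rparr>"

definition principal_sum ::
    "'a set_system \<Rightarrow> 'a set_system \<Rightarrow> 'a set \<Rightarrow> 'a set \<Rightarrow> 'a set_system" where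
  "principal_sum M N A B =
     matroid_union (free_extension M (ground N) A B) (direct_sum N (uniform 0 (ground M)))"

end

theory Submission
  imports Defs
begin

text \<open>
  A set $Z$ is a basis of $(M,N;A,B)$ iff it has $r(M) + r(N)$ elements, $Z \cap S$ is
  independent in $M$, $(Z \cap S) \cup A$ spans $M$, $Z \cap T$ spans $N$, and $(Z \cap T) - B$ is
  independent in $N$. As passing to complements exchanges independent sets of a matroid
  and spanning sets of its dual, the complements of these sets satisfy the same
  description for $(N^*,M^*;B,A)$.
\<close>

section \<open>Spanning sets, and the constructions unfolded\<close>

text \<open>Phrased by containment of a basis instead of by rank, so that taking complements in the
  ground set turns it directly into independence in \<open>dual M\<close>.\<close>

definition spanning :: "'a set_system \<Rightarrow> 'a set \<Rightarrow> bool" where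
  "spanning M X \<longleftrightarrow> (\<exists>K\<in>bases M. K \<subseteq> X)"

lemma ground_dual [simp]: "ground (dual M) = ground M"
  by (simp add: dual_def)

lemma ground_principal_sum [simp]: "ground (principal_sum M N A B) = ground M \<union> ground N"
  by (auto simp: principal_sum_def matroid_union_def free_extension_def direct_sum_def
      uniform_def)

lemma indep_dual_iff: "X \<in> indeps (dual M) \<longleftrightarrow> (\<exists>C\<in>bases M. X \<subseteq> ground M - C)"
  by (simp add: dual_def)

section \<open>Rank, extension of independent sets, and bases\<close>

context matroid
begin

lemma finite_indep: "I \<in> indeps M \<Longrightarrow> finite I"
  using finite_ground indep_subset_ground finite_subset by blast

lemma finite_indeps: "finite (indeps M)"
  by (rule finite_subset[of _ "Pow (ground M)"])
    (use indep_subset_ground finite_ground in auto)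

lemma card_le_rank: "I \<in> indeps M \<Longrightarrow> I \<subseteq> X \<Longrightarrow> card I \<le> rank M X"
  unfolding rank_def using finite_indeps by (intro Max_ge) auto

lemma ex_indep_card_eq_rank: "\<exists>I\<in>indeps M. I \<subseteq> X \<and> card I = rank M X"
proof -
  have "rank M X \<in> card ` {I \<in> indeps M. I \<subseteq> X}"
    unfolding rank_def using finite_indeps indep_empty by (intro Max_in) auto
  then show ?thesis by auto
qed

lemma rank_le_card: "finite X \<Longrightarrow> rank M X \<le> card X"
  using ex_indep_card_eq_rank[of X] card_mono by metis

lemma rank_le: "rank M X \<le> rank M (ground M)"
  using ex_indep_card_eq_rank[of X] card_le_rank indep_subset_ground by metis

lemma rank_indep: "I \<in> indeps M \<Longrightarrow> rank M I = card I"
  using card_le_rank[of I I] rank_le_card[of I] finite_indep by fastforce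

lemma indep_if_rank_eq_card: "finite X \<Longrightarrow> rank M X = card X \<Longrightarrow> X \<in> indeps M"
  using ex_indep_card_eq_rank[of X] card_subset_eq by metis

text \<open>Repeated augmentation from a largest independent subset of \<open>X\<close>; every new
  element comes from \<open>X\<close>, and the deficit \<open>rank M X - card I\<close> drops each
  time.\<close>

lemma indep_extend:
  assumes "I \<in> indeps M" "I \<subseteq> X"
  obtains K where "K \<in> indeps M" "I \<subseteq> K" "K \<subseteq> X" "card K = rank M X"
proof -
  have "\<exists>K\<in>indeps M. I \<subseteq> K \<and> K \<subseteq> X \<and> card K = rank M X"
    using assms
  proof (induction "rank M X - card I" arbitrary: I rule: less_induct)
    case less
    show ?case
    proof (cases "card I = rank M X")
      case True
      with less.prems show ?thesis by (intro bexI[of _ I]) auto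
    next
      case False
      then have lt: "card I < rank M X" 
        using card_le_rank[OF less.prems] by linarith
      obtain J where J: "J \<in> indeps M" "J \<subseteq> X" "card J = rank M X"
        using ex_indep_card_eq_rank by blast
      with lt obtain x where x: "x \<in> J - I" "insert x I \<in> indeps M"
        using indep_augment[OF less.prems(1) J(1)] J(3) by auto
      have "card (insert x I) = Suc (card I)"
        using x finite_indep[OF less.prems(1)] by simp
      then have "rank M X - card (insert x I) < rank M X - card I" using lt by simp
      moreover have "insert x I \<subseteq> X" using x J less.prems(2) by blast
      ultimately obtain K where "K \<in> indeps M" "insert x I \<subseteq> K" "K \<subseteq> X" "card K = rank M X"
        using less.hyps[OF _ x(2)] by auto
      then show ?thesis by auto
    qed
  qed
  then show thesis using that by blast
qed

text \<open>A maximal independent set coincides with its extension to full rank. Conversely, no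
  independent set exceeds the full rank, so one of that size has no proper independent
  superset.\<close>

lemma basis_iff: "K \<in> bases M \<longleftrightarrow> K \<in> indeps M \<and> card K = rank M (ground M)"
proof
  assume K: "K \<in> bases M"
  then have "K \<in> indeps M" by (simp add: bases_def)
  moreover from this obtain L where "L \<in> indeps M" "K \<subseteq> L" "card L = rank M (ground M)"
    using indep_extend indep_subset_ground by metis
  moreover from this have "L = K" using K by (auto simp: bases_def)
  ultimately show "K \<in> indeps M \<and> card K = rank M (ground M)" by simp
next
  assume K: "K \<in> indeps M \<and> card K = rank M (ground M)"
  then have "J = K" if "J \<in> indeps M" "K \<subseteq> J" for J
    using card_seteq[of J K] that finite_indep card_le_rank indep_subset_ground by metis
  then show "K \<in> bases M" using K by (auto simp: bases_def)
qed

lemma basis_indep: "K \<in> bases M \<Longrightarrow> K \<in> indeps M"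
  by (simp add: bases_def)

lemma card_basis: "K \<in> bases M \<Longrightarrow> card K = rank M (ground M)"
  by (simp add: basis_iff)

lemma basis_subset_ground: "K \<in> bases M \<Longrightarrow> K \<subseteq> ground M"
  by (simp add: basis_indep indep_subset_ground)

lemma finite_basis: "K \<in> bases M \<Longrightarrow> finite K"
  by (simp add: basis_indep finite_indep)

text \<open>A spanning set has full rank, so extending \<open>I\<close> inside \<open>X\<close> up
  to \<open>rank M X\<close> already reaches a basis.\<close>

lemma indep_extend_basis:
  assumes "I \<in> indeps M" "I \<subseteq> X" "spanning M X"
  obtains K where "K \<in> bases M" "I \<subseteq> K" "K \<subseteq> X"
proof -
  obtain L where "L \<in> bases M" "L \<subseteq> X" using assms by (auto simp: spanning_def)
  then have "rank M X = rank M (ground M)"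
    using card_le_rank[of L X] rank_le[of X] basis_iff by simp
  with indep_extend[OF assms(1,2)] that basis_iff show thesis by metis
qed

lemma spanning_ground: "spanning M (ground M)"
  using ex_indep_card_eq_rank[of "ground M"] basis_iff unfolding spanning_def by blast

lemma rank_spanning: "spanning M X \<Longrightarrow> rank M X = rank M (ground M)"
  using rank_le[of X] card_le_rank[of _ X] basis_iff unfolding spanning_def by fastforce

section \<open>The dual matroid\<close>

text \<open>All bases have the same size, so no complement of a basis properly contains another;
  hence each of them is maximal in the dual.\<close>

lemma bases_dual: "bases (dual M) = (\<lambda>C. ground M - C) ` bases M"
proof (intro equalityI subsetI)
  fix D assume D: "D \<in> bases (dual M)"
  then obtain C where C: "C \<in> bases M" "D \<subseteq> ground M - C"
    by (auto simp: bases_def indep_dual_iff)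
  then have "ground M - C \<in> indeps (dual M)" by (auto simp: indep_dual_iff)
  then have "D = ground M - C" using C D by (auto simp: bases_def)
  then show "D \<in> (\<lambda>C. ground M - C) ` bases M" using C by blast
next
  fix D assume "D \<in> (\<lambda>C. ground M - C) ` bases M"
  then obtain C where C: "C \<in> bases M" "D = ground M - C" by blast
  have "J = D" if "J \<in> indeps (dual M)" "D \<subseteq> J" for J
  proof -
    obtain C' where C': "C' \<in> bases M" "J \<subseteq> ground M - C'"
      using \<open>J \<in> indeps (dual M)\<close> by (auto simp: indep_dual_iff)
    then have "C' \<subseteq> C" using that C basis_subset_ground[OF C'(1)] by blast
    then have "C' = C" using C C' finite_basis basis_iff card_subset_eq by metis
    then show ?thesis using that C C' by blast
  qed
  then show "D \<in> bases (dual M)" using C by (auto simp: bases_def indep_dual_iff)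
qed

lemma indep_dual_iff_spanning:
  assumes "X \<subseteq> ground M"
  shows "X \<in> indeps (dual M) \<longleftrightarrow> spanning M (ground M - X)"
proof -
  have "X \<subseteq> ground M - C \<longleftrightarrow> C \<subseteq> ground M - X" if "C \<in> bases M" for C
    using assms basis_subset_ground[OF that] by blast
  then show ?thesis by (simp add: indep_dual_iff spanning_def)
qed

text \<open>\<open>X\<close> contains the complement of a basis \<open>C\<close> iff
  \<open>C\<close> contains the complement of \<open>X\<close>, and a set lies in some basis iff it
  is independent.\<close>

lemma spanning_dual_iff_indep:
  assumes "X \<subseteq> ground M"
  shows "spanning (dual M) X \<longleftrightarrow> ground M - X \<in> indeps M"
proof
  assume "spanning (dual M) X"
  then obtain C where C: "C \<in> bases M" "ground M - C \<subseteq> X"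
    by (auto simp: spanning_def bases_dual)
  then have "ground M - X \<subseteq> C" by blast
  with basis_indep[OF C(1)] show "ground M - X \<in> indeps M" by (rule indep_mono)
next
  assume "ground M - X \<in> indeps M"
  then obtain C where C: "C \<in> bases M" "ground M - X \<subseteq> C"
    using indep_extend_basis[OF _ Diff_subset spanning_ground] by metis
  then have "ground M - C \<subseteq> X" by blast
  with C show "spanning (dual M) X" by (auto simp: spanning_def bases_dual)
qed

lemma matroid_dual: "matroid (dual M)"
proof
  show "finite (ground (dual M))" by (simp add: finite_ground)
  show "I \<subseteq> ground (dual M)" if "I \<in> indeps (dual M)" for I
    using that by (auto simp: indep_dual_iff)
  show "{} \<in> indeps (dual M)"
    using spanning_ground by (auto simp: indep_dual_iff spanning_def)
  show "J \<in> indeps (dual M)" if "I \<in> indeps (dual M)" "J \<subseteq> I" for I J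
    using that unfolding indep_dual_iff by blast
  show "\<exists>x\<in>J - I. insert x I \<in> indeps (dual M)"
    if IJ: "I \<in> indeps (dual M)" "J \<in> indeps (dual M)" "card I < card J" for I J
  proof -
    obtain D where D: "D \<in> bases M" "I \<subseteq> ground M - D"
      using IJ by (auto simp: indep_dual_iff)
    obtain E where E: "E \<in> bases M" "J \<subseteq> ground M - E"
      using IJ by (auto simp: indep_dual_iff)
    have fin: "finite I" "finite J" "finite D" "finite E"
      using D E finite_ground finite_basis by (auto intro: finite_subset)
    \<comment> \<open>The idea is to find a basis \<open>C\<close> that still avoids
      \<open>I\<close> but takes as much of \<open>E\<close> as possible. Both \<open>E - I\<close>
      and \<open>D\<close> are disjoint from \<open>I\<close>, so any basis inside their union will
      do.\<close>
    have "E - I \<in> indeps M" using basis_indep[OF E(1)] by (rule indep_mono) blast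
    moreover have "spanning M ((E - I) \<union> D)" using D by (auto simp: spanning_def)
    ultimately obtain C where C: "C \<in> bases M" "E - I \<subseteq> C" "C \<subseteq> (E - I) \<union> D"
      using indep_extend_basis by blast
    \<comment> \<open>Otherwise the disjoint sets \<open>J - I\<close> and \<open>E - I\<close> both
      fit into \<open>C\<close>, which is as large as \<open>E\<close>. Then \<open>J - I\<close>
      has at most as many elements as \<open>E \<inter> I\<close>, which lies in
      \<open>I - J\<close> because \<open>J\<close> avoids \<open>E\<close>; this contradicts
      \<open>card I < card J\<close>.\<close>
    have "\<not> J - I \<subseteq> C"
    proof
      assume "J - I \<subseteq> C"
      then have "card ((J - I) \<union> (E - I)) \<le> card C"
        using C finite_basis by (intro card_mono) auto
      moreover have "card ((J - I) \<union> (E - I)) = card (J - I) + card (E - I)"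
        using fin E by (intro card_Un_disjoint) auto
      moreover have "card E = card (E - I) + card (E \<inter> I)"
        using fin card_Int_Diff[of E I] by simp
      moreover have "card (E \<inter> I) \<le> card (I - J)"
        using fin E by (intro card_mono) auto
      moreover have "card I = card (I - J) + card (I \<inter> J)"
        using fin card_Int_Diff[of I J] by simp
      moreover have "card J = card (J - I) + card (I \<inter> J)"
        using fin card_Int_Diff[of J I] by (simp add: Int_commute)
      moreover have "card C = card E" using C E card_basis by simp
      ultimately show False using IJ by linarith
    qed
    then obtain x where x: "x \<in> J - I" "x \<notin> C" by blast
    have "I \<inter> C = {}" using C D by blast
    then have "insert x I \<subseteq> ground M - C" using x D E by blast
    then show ?thesis using x C by (auto simp: indep_dual_iff)
  qed
qed

lemma rank_dual: "rank (dual M) (ground M) + rank M (ground M) = card (ground M)"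
proof -
  obtain C where C: "C \<in> bases M" using spanning_ground by (auto simp: spanning_def)
  then have "ground M - C \<in> bases (dual M)" by (simp add: bases_dual)
  then have "card (ground M - C) = rank (dual M) (ground M)"
    using matroid.basis_iff[OF matroid_dual] by simp
  moreover have "card (ground M - C) = card (ground M) - card C"
    using C finite_basis basis_subset_ground by (intro card_Diff_subset)
  moreover have "card C \<le> card (ground M)"
    using C finite_ground basis_subset_ground by (intro card_mono)
  moreover have "card C = rank M (ground M)" using C basis_iff by simp
  ultimately show ?thesis by simp
qed

section \<open>Independent sets of the two summands of the union\<close>

text \<open>The second argument of the minimum never exceeds \<open>card X + card Y\<close>. If the
  minimum attains this value, then \<open>rank M X = card X\<close> and \<open>Y \<inter> B\<close>
  is all of \<open>Y\<close>; the first argument contributes the remaining inequality.\<close>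

lemma indep_free_extension_iff:
  assumes "X \<subseteq> ground M" "Y \<subseteq> T" "finite T" "ground M \<inter> T = {}"
  shows "X \<union> Y \<in> indeps (free_extension M T A B) \<longleftrightarrow>
    X \<in> indeps M \<and> Y \<subseteq> B \<and> card X + card Y \<le> rank M (X \<union> A)"
proof -
  have fin: "finite X" "finite Y" using assms finite_ground finite_subset by blast+
  have card: "card (X \<union> Y) = card X + card Y"
    using fin assms by (intro card_Un_disjoint) auto
  have "X \<union> Y \<in> indeps (free_extension M T A B) \<longleftrightarrow>
      free_extension_rank M A B X Y = card (X \<union> Y)" (is "?L \<longleftrightarrow> ?R")
  proof
    assume ?L
    then obtain X' Y' where *: "X \<union> Y = X' \<union> Y'" "X' \<subseteq> ground M" "Y' \<subseteq> T"
      "free_extension_rank M A B X' Y' = card (X' \<union> Y')"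
      by (auto simp: free_extension_def)
    \<comment> \<open>Since \<open>ground M\<close> and \<open>T\<close> are disjoint, a set splits
      in only one way.\<close>
    then have "X' = X" "Y' = Y" using assms by blast+
    with * show ?R by simp
  next
    assume ?R
    then show ?L using assms by (auto simp: free_extension_def)
  qed
  also have "\<dots> \<longleftrightarrow> X \<in> indeps M \<and> Y \<subseteq> B \<and> card X + card Y \<le> rank M (X \<union> A)"
  proof
    assume R: "free_extension_rank M A B X Y = card (X \<union> Y)"
    have "rank M X \<le> card X" using fin rank_le_card by simp
    moreover have "card (Y \<inter> B) \<le> card Y" using fin by (intro card_mono) auto
    ultimately have "rank M X = card X" "card (Y \<inter> B) = card Y"
      "card X + card Y \<le> rank M (X \<union> A)"
      using R card by (auto simp: free_extension_rank_def)
    moreover from this have "Y \<inter> B = Y" using fin by (intro card_subset_eq) auto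
    ultimately show "X \<in> indeps M \<and> Y \<subseteq> B \<and> card X + card Y \<le> rank M (X \<union> A)"
      using indep_if_rank_eq_card fin by auto
  next
    assume "X \<in> indeps M \<and> Y \<subseteq> B \<and> card X + card Y \<le> rank M (X \<union> A)"
    then show "free_extension_rank M A B X Y = card (X \<union> Y)"
      using card rank_indep by (auto simp: free_extension_rank_def Int_absorb2)
  qed
  finally show ?thesis .
qed

end

text \<open>Adding loops creates no independent sets. Finiteness of \<open>S\<close> excludes
  infinite subsets, whose \<open>card\<close> is 0 by convention.\<close>

lemma indeps_direct_sum_uniform_0:
  assumes "finite S"
  shows "indeps (direct_sum N (uniform 0 S)) = indeps N"
proof -
  have "X \<subseteq> S \<and> card X \<le> 0 \<longleftrightarrow> X = {}" for X
    using finite_subset[of X, OF _ assms] by auto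
  then show ?thesis by (simp add: direct_sum_def uniform_def)
qed

section \<open>Bases and independent sets of the principal sum\<close>

text \<open>\<open>X\<close> and \<open>W\<close> stand for the parts of a basis in
  \<open>ground M\<close> and \<open>ground N\<close>. The independence and spanning conditions come
  in pairs that complementation exchanges.\<close>

definition principal_sum_basis ::
    "'a set_system \<Rightarrow> 'a set_system \<Rightarrow> 'a set \<Rightarrow> 'a set \<Rightarrow> 'a set \<Rightarrow> 'a set \<Rightarrow> bool" where
  "principal_sum_basis M N A B X W \<longleftrightarrow>
     X \<in> indeps M \<and> spanning M (X \<union> A) \<and>
     W \<subseteq> ground N \<and> spanning N W \<and> W - B \<in> indeps N \<and>
     card X + card W = rank M (ground M) + rank N (ground N)"

text \<open>These assumptions are preserved by passing to \<open>dual N\<close>,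
  \<open>dual M\<close>, \<open>B\<close>, \<open>A\<close>, so the results apply to both sides of
  the duality.\<close>

locale principal_sum_data = M: matroid M + N: matroid N
  for M N :: "'a set_system" and A B :: "'a set" +
  assumes disjoint: "ground M \<inter> ground N = {}"
    and A_subset: "A \<subseteq> ground M"
    and B_subset: "B \<subseteq> ground N"
begin

lemma finite_B: "finite B"
  using finite_subset[OF B_subset N.finite_ground] .

text \<open>\<open>X \<union> Y\<close> is the part from the free extension and \<open>J\<close> the
  part from \<open>N\<close>; \<open>Y\<close> and \<open>J\<close> may overlap.\<close>

lemma indep_principal_sum_iff:
  "Z \<in> indeps (principal_sum M N A B) \<longleftrightarrow>
    (\<exists>X Y J. Z = X \<union> Y \<union> J \<and> X \<in> indeps M \<and> Y \<subseteq> B \<and> J \<in> indeps N \<and>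
      card X + card Y \<le> rank M (X \<union> A))" (is "?L \<longleftrightarrow> ?R")
proof
  assume ?L
  then obtain I J where I: "I \<in> indeps (free_extension M (ground N) A B)"
    and J: "J \<in> indeps N" "Z = I \<union> J"
    by (auto simp: principal_sum_def matroid_union_def
        indeps_direct_sum_uniform_0[OF M.finite_ground])
  obtain X Y where "I = X \<union> Y" "X \<subseteq> ground M" "Y \<subseteq> ground N"
    using I by (auto simp: free_extension_def)
  with I J show ?R
    using M.indep_free_extension_iff[OF _ _ N.finite_ground disjoint, of X Y A B] by blast
next
  assume ?R
  then obtain X Y J where Z: "Z = X \<union> Y \<union> J" "X \<in> indeps M" "Y \<subseteq> B" "J \<in> indeps N"
      "card X + card Y \<le> rank M (X \<union> A)" by blast
  then have "X \<union> Y \<in> indeps (free_extension M (ground N) A B)"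
    using M.indep_free_extension_iff[OF _ _ N.finite_ground disjoint, of X Y A B]
      M.indep_subset_ground B_subset by blast
  with Z show ?L
    by (auto simp: principal_sum_def matroid_union_def
        indeps_direct_sum_uniform_0[OF M.finite_ground])
qed

text \<open>Intersect all three parts with \<open>Z'\<close>. Only the rank inequality needs care:
  replacing \<open>X\<close> by \<open>X \<inter> Z'\<close> lowers its left side by at least
  \<open>card (X - Z')\<close> and its right side by at most that.\<close>

lemma indep_principal_sum_mono:
  assumes "Z \<in> indeps (principal_sum M N A B)" "Z' \<subseteq> Z"
  shows "Z' \<in> indeps (principal_sum M N A B)"
proof -
  obtain X Y J where Z: "Z = X \<union> Y \<union> J" "X \<in> indeps M" "Y \<subseteq> B" "J \<in> indeps N"
      "card X + card Y \<le> rank M (X \<union> A)" using assms unfolding indep_principal_sum_iff by blast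
  have fin: "finite X" "finite Y"
    using M.finite_indep[OF Z(2)] finite_subset[OF Z(3) finite_B] .
  have "rank M (X \<union> A) \<le> rank M (X \<inter> Z' \<union> A) + card (X - Z')"
  proof -
    obtain I where I: "I \<in> indeps M" "I \<subseteq> X \<union> A" "card I = rank M (X \<union> A)"
      using M.ex_indep_card_eq_rank by blast
    \<comment> \<open>Deleting \<open>X - Z'\<close> from a largest independent subset of
      \<open>X \<union> A\<close> leaves an independent subset of
      \<open>X \<inter> Z' \<union> A\<close>.\<close>
    have "card I \<le> card (I - (X - Z')) + card (X - Z')"
      using diff_card_le_card_Diff[of "X - Z'" I] fin by simp
    moreover have "card (I - (X - Z')) \<le> rank M (X \<inter> Z' \<union> A)"
      using I(2) by (intro M.card_le_rank M.indep_mono[OF I(1)]) auto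
    ultimately show ?thesis using I by linarith
  qed
  moreover have "card X = card (X \<inter> Z') + card (X - Z')"
    using fin card_Int_Diff by blast
  moreover have "card (Y \<inter> Z') \<le> card Y" using fin by (intro card_mono) auto
  ultimately have "card (X \<inter> Z') + card (Y \<inter> Z') \<le> rank M (X \<inter> Z' \<union> A)"
    using Z by linarith
  moreover have "Z' = (X \<inter> Z') \<union> (Y \<inter> Z') \<union> (J \<inter> Z')" using Z assms by blast
  moreover have "X \<inter> Z' \<in> indeps M" "J \<inter> Z' \<in> indeps N"
    using M.indep_mono[OF Z(2) Int_lower1] N.indep_mono[OF Z(4) Int_lower1] .
  moreover have "Y \<inter> Z' \<subseteq> B" using Z(3) by blast
  ultimately show ?thesis unfolding indep_principal_sum_iff by blast
qed

text \<open>The free extension part is bounded by \<open>rank M (X \<union> A)\<close>, hence by the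
  rank of \<open>M\<close>, and \<open>J\<close> by the rank of \<open>N\<close>. An independent set
  attaining the sum is therefore maximal.\<close>

lemma card_indep_principal_sum_le:
  assumes "Z \<in> indeps (principal_sum M N A B)"
  shows "finite Z" "card Z \<le> rank M (ground M) + rank N (ground N)"
proof -
  obtain X Y J where Z: "Z = X \<union> Y \<union> J" "X \<in> indeps M" "Y \<subseteq> B" "J \<in> indeps N"
      "card X + card Y \<le> rank M (X \<union> A)" using assms unfolding indep_principal_sum_iff by blast
  have "finite Y" using finite_subset[OF Z(3) finite_B] .
  then show "finite Z" using Z(1) M.finite_indep[OF Z(2)] N.finite_indep[OF Z(4)] by simp
  have "card Z \<le> card X + card Y + card J"
    unfolding Z(1) using card_Un_le[of "X \<union> Y" J] card_Un_le[of X Y] by linarith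
  moreover have "card J \<le> rank N (ground N)"
    using N.card_le_rank[OF Z(4) N.indep_subset_ground[OF Z(4)]] .
  ultimately show "card Z \<le> rank M (ground M) + rank N (ground N)"
    using Z(5) M.rank_le[of "X \<union> A"] by linarith
qed

text \<open>A basis \<open>K\<close> of \<open>N\<close> between \<open>W - B\<close> and
  \<open>W\<close> serves as the part from \<open>N\<close>. The rest \<open>W - K\<close> lies in
  \<open>B\<close>, and the cardinality equation leaves it exactly the room that
  \<open>rank M (X \<union> A)\<close>, equal to the rank of \<open>M\<close>, offers beyond
  \<open>card X\<close>.\<close>

lemma principal_sum_basis_in_bases:
  assumes "principal_sum_basis M N A B X W"
  shows "X \<union> W \<in> bases (principal_sum M N A B)"
proof -
  note * = assms[unfolded principal_sum_basis_def]
  have fin: "finite X" "finite W" 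
    using * M.finite_indep finite_subset[OF _ N.finite_ground] by simp_all
  have WB: "W - B \<in> indeps N" and WN: "spanning N W" using * by simp_all
  obtain K where K: "K \<in> bases N" "W - B \<subseteq> K" "K \<subseteq> W"
    using N.indep_extend_basis[OF WB Diff_subset WN] .
  have "card W = card K + card (W - K)"
    using K fin card_Int_Diff[of W K] by (simp add: Int_absorb1)
  then have "card X + card (W - K) \<le> rank M (X \<union> A)"
    using * N.card_basis[OF K(1)] M.rank_spanning[of "X \<union> A"] by simp
  moreover have "X \<union> W = X \<union> (W - K) \<union> K" "W - K \<subseteq> B" using K by blast+
  ultimately have indep: "X \<union> W \<in> indeps (principal_sum M N A B)"
    unfolding indep_principal_sum_iff using * N.basis_indep[OF K(1)] by blast
  have "card (X \<union> W) = rank M (ground M) + rank N (ground N)"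
  proof -
    have "X \<subseteq> ground M" "W \<subseteq> ground N" using * M.indep_subset_ground by simp_all
    then have "X \<inter> W = {}" using disjoint by blast
    then show ?thesis using * fin by (simp add: card_Un_disjoint)
  qed
  then have "J = X \<union> W" if "J \<in> indeps (principal_sum M N A B)" "X \<union> W \<subseteq> J" for J
    using card_indep_principal_sum_le[OF that(1)] card_seteq[of J "X \<union> W"] that(2) by simp
  with indep show ?thesis unfolding bases_def by blast
qed

text \<open>Enlarge \<open>J\<close> to a basis of \<open>N\<close> and \<open>X\<close> to a basis
  of \<open>M\<close>, then delete from the latter as many elements of \<open>A\<close> as
  \<open>Y\<close> contributes beyond the former, so that the total is the sum of the ranks.\<close>

lemma indep_extend_principal_sum_basis:
  assumes "Z \<in> indeps (principal_sum M N A B)"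
  obtains X W where "principal_sum_basis M N A B X W" "Z \<subseteq> X \<union> W"
proof -
  obtain X Y J where Z: "Z = X \<union> Y \<union> J" "X \<in> indeps M" "Y \<subseteq> B" "J \<in> indeps N"
      "card X + card Y \<le> rank M (X \<union> A)" using assms unfolding indep_principal_sum_iff by blast
  have finY: "finite Y" using finite_subset[OF Z(3) finite_B] .
  obtain K where K: "K \<in> bases N" "J \<subseteq> K"
    using N.indep_extend_basis[OF Z(4) N.indep_subset_ground[OF Z(4)] N.spanning_ground] .
  have finK: "finite K" using N.finite_basis[OF K(1)] .
  \<comment> \<open>\<open>K\<close> may absorb part of \<open>Y\<close>; only \<open>Y - K\<close>
    is in excess of a basis of \<open>N\<close>.\<close>
  define W where "W = (Y - K) \<union> K"
  have cardW: "card W = card (Y - K) + rank N (ground N)"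
    unfolding W_def using finY finK N.card_basis[OF K(1)] by (subst card_Un_disjoint) auto
  \<comment> \<open>Extending first inside \<open>X \<union> A\<close> ensures that the later basis
    \<open>D\<close> has enough elements of \<open>A\<close> outside \<open>X\<close>.\<close>
  obtain L where L: "L \<in> indeps M" "X \<subseteq> L" "L \<subseteq> X \<union> A" "card L = rank M (X \<union> A)"
    using M.indep_extend[OF Z(2) Un_upper1] .
  obtain D where D: "D \<in> bases M" "L \<subseteq> D"
    using M.indep_extend_basis[OF L(1) M.indep_subset_ground[OF L(1)] M.spanning_ground] .
  have fin: "finite X" "finite L" "finite D" 
    using M.finite_indep[OF Z(2)] M.finite_indep[OF L(1)] M.finite_basis[OF D(1)] .
  \<comment> \<open>\<open>R\<close> compensates for the excess \<open>Y - K\<close>. There is room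
    for it, as \<open>L - X\<close> has \<open>rank M (X \<union> A) - card X\<close> elements,
    which is at least \<open>card Y\<close>.\<close>
  have "card (Y - K) \<le> card Y" using finY by (intro card_mono) auto
  also have "\<dots> \<le> card (L - X)" using L Z(5) fin card_Diff_subset[of X L] by simp
  finally obtain R where R: "R \<subseteq> L - X" "card R = card (Y - K)"
    by (rule obtain_subset_with_card_n)
  have "card (D - R) + card R = rank M (ground M)"
  proof -
    have "R \<subseteq> D" using R L D by blast
    then show ?thesis
      using fin M.card_basis[OF D(1)] card_mono[of D R] card_Diff_subset[of R D]
        finite_subset[of R D] by simp
  qed
  moreover have "spanning M ((D - R) \<union> A)"
  proof -
    \<comment> \<open>The deleted elements lie in \<open>L - X\<close>, hence in
      \<open>A\<close>.\<close>
    have "D \<subseteq> (D - R) \<union> A" using R(1) L(3) by blast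
    with D(1) show ?thesis unfolding spanning_def by blast
  qed
  moreover have "D - R \<in> indeps M" using M.basis_indep[OF D(1)] by (rule M.indep_mono) blast
  moreover have "W \<subseteq> ground N" "spanning N W"
    using Z(3) K B_subset N.basis_subset_ground[OF K(1)] by (auto simp: W_def spanning_def)
  moreover have "W - B \<in> indeps N"
    using N.basis_indep[OF K(1)] by (rule N.indep_mono) (use Z(3) in \<open>auto simp: W_def\<close>)
  ultimately have "principal_sum_basis M N A B (D - R) W"
    using cardW R by (simp add: principal_sum_basis_def)
  moreover have "Z \<subseteq> (D - R) \<union> W"
    unfolding Z(1) W_def using K(2) D(2) L(2) R(1) by blast
  ultimately show thesis using that by blast
qed

text \<open>A maximal independent set equals the set \<open>X \<union> W\<close> that extends it, as
  that set is itself independent.\<close>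

lemma bases_principal_sum_iff:
  "Z \<in> bases (principal_sum M N A B) \<longleftrightarrow>
    (\<exists>X W. principal_sum_basis M N A B X W \<and> Z = X \<union> W)"
proof
  assume Z: "Z \<in> bases (principal_sum M N A B)"
  then have "Z \<in> indeps (principal_sum M N A B)" by (simp add: bases_def)
  then obtain X W where XW: "principal_sum_basis M N A B X W" "Z \<subseteq> X \<union> W"
    by (rule indep_extend_principal_sum_basis)
  then have "X \<union> W = Z"
    using Z principal_sum_basis_in_bases[OF XW(1)] by (simp add: bases_def)
  with XW show "\<exists>X W. principal_sum_basis M N A B X W \<and> Z = X \<union> W" by blast
qed (use principal_sum_basis_in_bases in blast)

text \<open>This form matches independence in a dual, which means lying in the complement of a
  basis; the direction from right to left rests on heredity.\<close>

lemma indep_principal_sum_iff_basis: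
  "Z \<in> indeps (principal_sum M N A B) \<longleftrightarrow>
    (\<exists>X W. principal_sum_basis M N A B X W \<and> Z \<subseteq> X \<union> W)"
proof
  assume "\<exists>X W. principal_sum_basis M N A B X W \<and> Z \<subseteq> X \<union> W"
  then obtain X W where "X \<union> W \<in> bases (principal_sum M N A B)" "Z \<subseteq> X \<union> W"
    using principal_sum_basis_in_bases by blast
  then show "Z \<in> indeps (principal_sum M N A B)"
    using indep_principal_sum_mono[of "X \<union> W" Z] by (simp add: bases_def)
qed (use indep_extend_principal_sum_basis in blast)

section \<open>Complementation and the duality\<close>

text \<open>Complementation matches the conditions in pairs: independence of \<open>X\<close> with
  spanning of its complement in \<open>dual M\<close>, spanning of \<open>X \<union> A\<close> with
  independence of the complement minus \<open>A\<close>, and likewise for \<open>N\<close> and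
  \<open>B\<close>.\<close>

lemma principal_sum_basis_dual:
  assumes "X \<subseteq> ground M" "W \<subseteq> ground N"
  shows "principal_sum_basis (dual N) (dual M) B A (ground N - W) (ground M - X) \<longleftrightarrow>
    principal_sum_basis M N A B X W"
proof -
  have "ground N - W \<in> indeps (dual N) \<longleftrightarrow> spanning N W"
    using assms N.indep_dual_iff_spanning[of "ground N - W"] by (simp add: double_diff)
  moreover have "spanning (dual N) (ground N - W \<union> B) \<longleftrightarrow> W - B \<in> indeps N"
  proof -
    have "ground N - (ground N - W \<union> B) = W - B" using assms by blast
    then show ?thesis using assms B_subset N.spanning_dual_iff_indep[of "ground N - W \<union> B"] by simp
  qed
  moreover have "spanning (dual M) (ground M - X) \<longleftrightarrow> X \<in> indeps M"
    using assms M.spanning_dual_iff_indep[of "ground M - X"] by (simp add: double_diff)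
  moreover have "ground M - X - A \<in> indeps (dual M) \<longleftrightarrow> spanning M (X \<union> A)"
  proof -
    have "ground M - (ground M - X - A) = X \<union> A" using assms A_subset by blast
    then show ?thesis using M.indep_dual_iff_spanning[of "ground M - X - A"] by auto
  qed
  \<comment> \<open>Complementary sets, and the ranks of a matroid and its dual, both add up to the
    size of the ground set, so the two equations are equivalent.\<close>
  moreover have "card (ground N - W) + card (ground M - X) =
      rank (dual N) (ground N) + rank (dual M) (ground M) \<longleftrightarrow>
      card X + card W = rank M (ground M) + rank N (ground N)"
  proof -
    have "card (ground N - W) + card W = card (ground N)"
      using assms N.finite_ground card_Diff_subset[of W "ground N"] card_mono[of "ground N" W]
        finite_subset[of W] by simp
    moreover have "card (ground M - X) + card X = card (ground M)"
      using assms M.finite_ground card_Diff_subset[of X "ground M"] card_mono[of "ground M" X]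
        finite_subset[of X] by simp
    ultimately show ?thesis using M.rank_dual N.rank_dual by linarith
  qed
  ultimately show ?thesis using assms by (auto simp: principal_sum_basis_def)
qed

end

theorem theorem3p8:
  fixes M N :: "'a set_system" and S T A B :: "'a set"
  assumes "matroid M" and "ground M = S"
    and "matroid N" and "ground N = T"
    and "S \<inter> T = {}"
    and "A \<subseteq> S" and "B \<subseteq> T"
  shows "dual (principal_sum M N A B) = principal_sum (dual N) (dual M) B A"
proof -
  interpret P: principal_sum_data M N A B
    using assms by (simp add: principal_sum_data_def principal_sum_data_axioms_def)
  interpret D: principal_sum_data "dual N" "dual M" B A
    using assms P.M.matroid_dual P.N.matroid_dual
    by (simp add: principal_sum_data_def principal_sum_data_axioms_def Int_commute)
  have sub: "X \<subseteq> S" "W \<subseteq> T" if "principal_sum_basis M N A B X W" for X W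
    using that assms P.M.indep_subset_ground by (auto simp: principal_sum_basis_def)
  have "Z \<in> indeps (dual (principal_sum M N A B)) \<longleftrightarrow>
      Z \<in> indeps (principal_sum (dual N) (dual M) B A)" for Z
  proof
    assume "Z \<in> indeps (dual (principal_sum M N A B))"
    \<comment> \<open>\<open>Z\<close> avoids a basis \<open>X \<union> W\<close>, so it lies in the
      union of the two complements, a basis of the other principal sum.\<close>
    then obtain X W where XW: "principal_sum_basis M N A B X W" "Z \<subseteq> S \<union> T - (X \<union> W)"
      using assms by (auto simp: indep_dual_iff P.bases_principal_sum_iff)
    then have "principal_sum_basis (dual N) (dual M) B A (T - W) (S - X)"
      using P.principal_sum_basis_dual[of X W] sub assms by simp
    moreover have "Z \<subseteq> (T - W) \<union> (S - X)" using XW by blast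
    ultimately show "Z \<in> indeps (principal_sum (dual N) (dual M) B A)"
      using D.indep_principal_sum_iff_basis by blast
  next
    assume "Z \<in> indeps (principal_sum (dual N) (dual M) B A)"
    then obtain V U where VU: "principal_sum_basis (dual N) (dual M) B A V U" "Z \<subseteq> V \<union> U"
      using D.indep_principal_sum_iff_basis by blast
    then have "V \<subseteq> T" "U \<subseteq> S"
      using assms D.M.indep_subset_ground by (auto simp: principal_sum_basis_def)
    \<comment> \<open>Complementing twice recovers \<open>U\<close> and \<open>V\<close>, so the
      same equivalence is read backwards.\<close>
    then have "principal_sum_basis M N A B (S - U) (T - V)"
      using P.principal_sum_basis_dual[of "S - U" "T - V"] VU assms by (simp add: double_diff)
    then have "(S - U) \<union> (T - V) \<in> bases (principal_sum M N A B)"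
      by (rule P.principal_sum_basis_in_bases)
    \<comment> \<open>Disjointness of \<open>S\<close> and \<open>T\<close> keeps \<open>V\<close>
      away from \<open>S - U\<close> and \<open>U\<close> away from \<open>T - V\<close>.\<close>
    moreover have "Z \<subseteq> S \<union> T - ((S - U) \<union> (T - V))"
      using VU \<open>V \<subseteq> T\<close> \<open>U \<subseteq> S\<close> assms by blast
    ultimately show "Z \<in> indeps (dual (principal_sum M N A B))"
      unfolding indep_dual_iff using assms by auto
  qed
  then show ?thesis
    by (intro set_system.equality) (auto simp: dual_def[of "principal_sum M N A B"])
qed

end
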